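(* Let $(z^k)_{k\ge0}$ be a sequence generated by the Implicit Fast OGDA algorithm described in the context, where $(\beta_k)_{k\ge0}$ is a positive and nondecreasing sequence which satisfies $$0\le\sup_{k\ge1}\frac{k(\beta_k-\beta_{k-1})}{\beta_k}<\alpha-2.$$ Then $(z^k)_{k\ge0}$ converges weakly to a solution of the equation $V(z)=0$.
   Context: $\mathcal H$ is a real Hilbert space, $V\colon\mathcal H\to\mathcal H$ is monotone ($\langle x-y,V(x)-V(y)\rangle\ge0$ for all $x,y\in\mathcal H$) and continuous, and $\mathcal Z:=\{z\in\mathcal H: V(z)=0\}$ is assumed nonempty. Implicit Fast OGDA algorithm: let $\alpha>2$, $z^0,z^1\in\mathcal H$, $s>0$, and let $(\beta_k)_{k\ge0}$ be a positive nondecreasing sequence with $0\le\sup_{k\ge1}\frac{k(\beta_k-\beta_{k-1})}{\beta_k}<\alpha-2$. For every $k\ge1$, $z^{k+1}$ is the (unique) element satisfying $$z^{k+1}=z^k+\Big(1-\frac{\alpha}{k+\alpha}\Big)(z^k-z^{k-1})-\frac{s\big(\alpha\beta_k+k(\beta_k-\beta_{k-1})\big)}{2(k+\alpha)}V(z^{k+1})-\frac{sk\beta_{k-1}}{k+\alpha}\big(V(z^{k+1})-V(z^k)\big).$$ *)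

theory Defs
  imports "HOL-Analysis.Analysis"
begin

definition monotone_operator :: "('a::real_inner \<Rightarrow> 'a) \<Rightarrow> bool" where
  "monotone_operator V \<longleftrightarrow> (\<forall>x y. (x - y) \<bullet> (V x - V y) \<ge> 0)"

definition zeros :: "('a::real_inner \<Rightarrow> 'a) \<Rightarrow> 'a set" where
  "zeros V = {z. V z = 0}"

definition weakly_converges_to :: "(nat \<Rightarrow> 'a::real_normed_vector) \<Rightarrow> 'a \<Rightarrow> bool" where
  "weakly_converges_to z l \<longleftrightarrow>
     (\<forall>f :: 'a \<Rightarrow> real. bounded_linear f \<longrightarrow> (\<lambda>k. f (z k)) \<longlonglongrightarrow> f l)"

text \<open>The scheme is implicit: \<^term>\<open>z (k + 1)\<close> occurs on both sides. When \<^term>\<open>V\<close> is monotone and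
  continuous on a Hilbert space and the coefficients of \<^term>\<open>V (z (k + 1))\<close> are nonpositive, the
  equation has exactly one solution, so it determines the sequence from \<^term>\<open>z 0\<close> and \<^term>\<open>z 1\<close>.\<close>

definition implicit_fast_ogda ::
    "('a::real_inner \<Rightarrow> 'a) \<Rightarrow> real \<Rightarrow> real \<Rightarrow> (nat \<Rightarrow> real) \<Rightarrow> (nat \<Rightarrow> 'a) \<Rightarrow> bool" where
  "implicit_fast_ogda V \<alpha> s \<beta> z \<longleftrightarrow>
     (\<forall>k\<ge>1. z (k + 1) = z k
        + (1 - \<alpha> / (real k + \<alpha>)) *\<^sub>R (z k - z (k - 1))
        - (s * (\<alpha> * \<beta> k + real k * (\<beta> k - \<beta> (k - 1))) / (2 * (real k + \<alpha>))) *\<^sub>R V (z (k + 1))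
        - (s * real k * \<beta> (k - 1) / (real k + \<alpha>)) *\<^sub>R (V (z (k + 1)) - V (z k)))"

end

theory Submission imports Defs begin

text \<open>
  The proof is a discrete Lyapunov argument followed by Opial's lemma.

  Fix a zero \<open>p\<close> of \<open>V\<close> and write \<open>x\<^sub>k = z\<^sub>k - p\<close>, \<open>d\<^sub>k = z\<^sub>k - z\<^sub>k\<^sub>-\<^sub>1\<close>,
  \<open>v\<^sub>k = V z\<^sub>k\<close>, \<open>b\<^sub>k = s \<beta>\<^sub>k\<^sub>-\<^sub>1\<close>. For a parameter \<open>\<mu>\<close> slightly below \<open>\<alpha> - 1\<close> the quantity
  \<open>energy\<close> is nonnegative, and along the iteration it eventually decreases, dissipating a multiple of
  \<open>b\<^sub>k \<langle>x\<^sub>k, v\<^sub>k\<rangle> + k \<parallel>d\<^sub>k\<parallel>\<^sup>2\<close> in each step (\<open>energy_dissipation\<close>). The growth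
  condition on \<open>\<beta>\<close> provides a gap \<open>\<epsilon> > 0\<close> between \<open>\<alpha> - 2\<close> and the supremum, and the admissible
  parameters are those with \<open>0 < \<alpha> - 1 - \<mu> < \<epsilon>\<close>. Boundedness of the energy gives
  \<open>\<parallel>v\<^sub>k\<parallel> = O(1 / k)\<close>.

  Modulo terms that do not depend on \<open>\<mu>\<close> the energy is linear in \<open>\<mu>\<close>. Two admissible parameters
  therefore show that
  \<open>(\<alpha> - 1) \<parallel>x\<^sub>k\<parallel>\<^sup>2 + 2 k \<langle>x\<^sub>k, d\<^sub>k + b\<^sub>k v\<^sub>k\<rangle>\<close> converges. Up to convergent
  terms this is \<open>(\<alpha> - 1) Q\<^sub>k + k (Q\<^sub>k - Q\<^sub>k\<^sub>-\<^sub>1)\<close>, where \<open>Q\<^sub>k\<close> is \<open>\<parallel>x\<^sub>k\<parallel>\<^sup>2\<close> plus twice the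
  partial sum up to \<open>k\<close> of the convergent series of the \<open>b\<^sub>i \<langle>x\<^sub>i, v\<^sub>i\<rangle>\<close>. A discrete l'Hopital rule
  (\<open>discrete_lhopital\<close>) yields convergence of \<open>Q\<^sub>k\<close>, hence of \<open>\<parallel>z\<^sub>k - p\<parallel>\<close> for every zero \<open>p\<close>.

  Since \<open>V z\<^sub>k\<close> tends to \<open>0\<close>, Minty's argument identifies every weak cluster point as a zero of \<open>V\<close>
  (\<open>weak_limit_is_zero\<close>), and Opial's lemma (\<open>opial\<close>) concludes. Weak compactness is used for
  cluster points along filters: these come directly from Tychonoff's theorem and the Riesz
  representation, which covers spaces of arbitrary dimension.
\<close>

section \<open>Weak convergence in Hilbert spaces\<close>

text \<open>The representing vector is the minimizer of \<open>\<parallel>x\<parallel>\<^sup>2 - 2 f x\<close>: minimizing sequences are Cauchy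
  by the parallelogram identity, and the first-order condition at the minimum is the claim.\<close>

lemma riesz_representation:
  fixes f :: "'a::{real_inner, complete_space} \<Rightarrow> real"
  assumes f: "bounded_linear f"
  obtains l where "\<And>y. f y = l \<bullet> y"
proof -
  interpret f: bounded_linear f by (rule f)
  define J where "J = (\<lambda>x. (norm x)\<^sup>2 - 2 * f x)"
  obtain B where B: "\<And>x. norm (f x) \<le> norm x * B"
    using f.bounded by blast
  have J_lower: "- B\<^sup>2 \<le> J x" for x
  proof -
    have "0 \<le> (norm x - B)\<^sup>2" by simp
    moreover have "f x \<le> norm x * B" using B[of x] by auto
    ultimately show ?thesis by (simp add: J_def power2_diff)
  qed
  define m where "m = (INF x. J x)"
  have bdd: "bdd_below (range J)" using J_lower by (meson bdd_belowI2)
  have m_le: "m \<le> J x" for x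
    unfolding m_def by (rule cINF_lower[OF bdd]) simp
  have "\<exists>x. J x < m + 1 / real (Suc n)" for n
    using cINF_less_iff[OF _ bdd, of "m + 1 / real (Suc n)"] by (simp add: m_def)
  then obtain X where X: "\<And>n. J (X n) < m + 1 / real (Suc n)" by metis
  have parallelogram: "(norm (a - b))\<^sup>2 \<le> 2 * (J a + J b - 2 * m)" for a b
  proof -
    have "J a + J b = 2 * J ((1/2) *\<^sub>R (a + b)) + (norm (a - b))\<^sup>2 / 2"
      by (simp add: J_def f.add f.scaleR power2_norm_eq_inner inner_simps inner_commute field_simps)
    then show ?thesis using m_le[of "(1/2) *\<^sub>R (a + b)"] by simp
  qed
  have "Cauchy X"
  proof (rule metric_CauchyI)
    fix e :: real assume e: "e > 0"
    then obtain N where N: "1 / real (Suc N) < e\<^sup>2 / 4"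
      using nat_approx_posE[of "e\<^sup>2 / 4"] by auto
    have J_N: "J (X n) < m + e\<^sup>2 / 4" if "n \<ge> N" for n
    proof -
      have "1 / real (Suc n) \<le> 1 / real (Suc N)" using that by (simp add: frac_le)
      then show ?thesis using X[of n] N by linarith
    qed
    have "dist (X i) (X j) < e" if "i \<ge> N" "j \<ge> N" for i j
    proof -
      have "(norm (X i - X j))\<^sup>2 < e\<^sup>2"
        using parallelogram[of "X i" "X j"] J_N[OF that(1)] J_N[OF that(2)] by simp
      then show ?thesis using e by (simp add: dist_norm power2_less_imp_less)
    qed
    then show "\<exists>M. \<forall>i\<ge>M. \<forall>j\<ge>M. dist (X i) (X j) < e" by blast
  qed
  then obtain l where l: "X \<longlonglongrightarrow> l"
    using Cauchy_convergent_iff convergent_def by blast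
  have "(\<lambda>n. J (X n)) \<longlonglongrightarrow> J l"
    unfolding J_def by (intro tendsto_intros l f.tendsto)
  moreover have "(\<lambda>n. m + 1 / real (Suc n)) \<longlonglongrightarrow> m + 0"
    by (intro tendsto_intros lim_1_over_n[THEN LIMSEQ_Suc])
  ultimately have "J l \<le> m + 0"
    by (rule LIMSEQ_le) (use X in \<open>auto intro: less_imp_le\<close>)
  then have J_min: "J l \<le> J x" for x using m_le[of x] by linarith
  have "f y = l \<bullet> y" for y
  proof -
    define q where "q = (\<lambda>t. J (l + t *\<^sub>R y))"
    have q: "q t = J l + t * (2 * (l \<bullet> y - f y)) + t\<^sup>2 * (y \<bullet> y)" for t
      unfolding q_def J_def power2_norm_eq_inner f.add f.scaleR
      by (simp add: inner_simps inner_commute power2_eq_square algebra_simps)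
    have "(q has_real_derivative 2 * (l \<bullet> y - f y)) (at 0)"
      unfolding q by (auto intro!: derivative_eq_intros)
    moreover have "q 0 \<le> q t" for t using J_min by (simp add: q_def)
    ultimately have "2 * (l \<bullet> y - f y) = 0"
      using DERIV_local_min[of q "2 * (l \<bullet> y - f y)" 0 1] by auto
    then show ?thesis by simp
  qed
  then show ?thesis by (rule that)
qed

text \<open>Sending \<open>z k\<close> to the functional \<open>\<lambda>y. z k \<bullet> y\<close> maps the family into a product of compact
  intervals. Tychonoff's theorem gives a pointwise cluster point of these functionals; it is again
  linear and bounded, hence an inner product with some \<open>l\<close>. Stating this for an arbitrary filter \<open>F\<close>
  replaces the passage to subsequences and allows \<open>F\<close> to be concentrated on a prescribed set of
  indices.\<close>

lemma bounded_weak_cluster_point: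
  fixes z :: "'i \<Rightarrow> 'a::{real_inner, complete_space}"
  assumes bound: "\<And>k. norm (z k) \<le> M" and F: "F \<noteq> bot"
  obtains G l where "G \<le> F" "G \<noteq> bot" "\<And>y. ((\<lambda>k. z k \<bullet> y) \<longlongrightarrow> l \<bullet> y) G"
proof -
  define \<Phi> :: "'i \<Rightarrow> 'a \<Rightarrow> real" where "\<Phi> k y = z k \<bullet> y" for k y
  define K :: "('a \<Rightarrow> real) set" where "K = (\<Pi>\<^sub>E y\<in>UNIV. {- (M * norm y) .. M * norm y})"
  have "compactin (product_topology (\<lambda>i::'a. euclideanreal) UNIV) K"
    unfolding K_def compactin_PiE by simp
  then have "compact K"
    by (simp add: euclidean_product_topology)
  moreover have \<Phi>K: "\<Phi> k \<in> K" for k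
  proof -
    have "\<bar>z k \<bullet> y\<bar> \<le> M * norm y" for y
      using Cauchy_Schwarz_ineq2[of "z k" y] mult_right_mono[OF bound[of k] norm_ge_zero[of y]]
      by linarith
    then show ?thesis by (auto simp: K_def \<Phi>_def abs_le_iff minus_le_iff)
  qed
  then have "eventually (\<lambda>h. h \<in> K) (filtermap \<Phi> F)"
    by (simp add: eventually_filtermap)
  moreover have "filtermap \<Phi> F \<noteq> bot" using F by (simp add: filtermap_bot_iff)
  ultimately obtain g where gK: "g \<in> K" and g: "inf (nhds g) (filtermap \<Phi> F) \<noteq> bot"
    unfolding compact_filter by blast
  define G where "G = inf (filtercomap \<Phi> (nhds g)) F"
  \<comment> \<open>If \<open>G\<close> were improper, \<open>F\<close> would eventually keep \<open>\<Phi>\<close> out of a neighbourhood of \<open>g\<close>.\<close>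
  have "G \<noteq> bot"
  proof
    assume "G = bot"
    then obtain P Q where P: "eventually P (filtercomap \<Phi> (nhds g))" and Q: "eventually Q F"
      and PQ: "\<And>k. P k \<Longrightarrow> Q k \<Longrightarrow> False"
      unfolding G_def trivial_limit_def eventually_inf by blast
    obtain R where R: "eventually R (nhds g)" "\<And>k. R (\<Phi> k) \<Longrightarrow> P k"
      using P unfolding eventually_filtercomap by blast
    have "eventually (\<lambda>h. \<not> R h) (filtermap \<Phi> F)"
      unfolding eventually_filtermap using Q by eventually_elim (use R PQ in blast)
    with R(1) have "eventually (\<lambda>h. False) (inf (nhds g) (filtermap \<Phi> F))"
      unfolding eventually_inf by blast
    then show False using g by (simp add: trivial_limit_def)
  qed
  have \<Phi>_lim: "(\<Phi> \<longlongrightarrow> g) G"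
    unfolding G_def by (rule filterlim_mono[OF filterlim_filtercomap order_refl inf_le1])
  have lim: "((\<lambda>k. z k \<bullet> y) \<longlongrightarrow> g y) G" for y
    using continuous_on_tendsto_compose[OF continuous_on_product_coordinates[of y] \<Phi>_lim]
    by (simp add: \<Phi>_def)
  have "bounded_linear g"
  proof (rule bounded_linear_intro[where K = M])
    show "g (x + y) = g x + g y" for x y
      using tendsto_add[OF lim[of x] lim[of y]] lim[of "x + y"] tendsto_unique[OF \<open>G \<noteq> bot\<close>]
      by (simp add: inner_add_right) 
    show "g (r *\<^sub>R x) = r *\<^sub>R g x" for r x
      using tendsto_mult_left[OF lim[of x], of r] lim[of "r *\<^sub>R x"] tendsto_unique[OF \<open>G \<noteq> bot\<close>]
      by simp
    show "norm (g x) \<le> norm x * M" for x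
    proof -
      have "g x \<in> {- (M * norm x) .. M * norm x}" using gK by (auto simp: K_def)
      then show ?thesis by (simp add: abs_le_iff mult.commute)
    qed
  qed
  then obtain l where "\<And>y. g y = l \<bullet> y" by (rule riesz_representation) blast
  with lim have "\<And>y. ((\<lambda>k. z k \<bullet> y) \<longlongrightarrow> l \<bullet> y) G" by simp
  moreover have "G \<le> F" by (simp add: G_def)
  ultimately show ?thesis using \<open>G \<noteq> bot\<close> that by blast
qed

text \<open>Minty's argument: monotonicity passes to the weak limit in the form
  \<open>\<langle>y - l, V y\<rangle> \<ge> 0\<close> for all \<open>y\<close>, because \<open>V (z k)\<close> tends to \<open>0\<close> strongly while \<open>z k\<close> stays
  bounded. Testing with \<open>y = l - t V l\<close> and letting \<open>t\<close> decrease to \<open>0\<close> gives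
  \<open>- \<parallel>V l\<parallel>\<^sup>2 \<ge> 0\<close>.\<close>

lemma weak_limit_is_zero:
  fixes V :: "'a::real_inner \<Rightarrow> 'a"
  assumes mono: "monotone_operator V" and cont: "continuous_on UNIV V"
    and G: "G \<noteq> bot" and bound: "\<And>k. norm (z k) \<le> M"
    and weak: "\<And>y. ((\<lambda>k. z k \<bullet> y) \<longlongrightarrow> l \<bullet> y) G"
    and residual: "((\<lambda>k. V (z k)) \<longlongrightarrow> 0) G"
  shows "V l = 0"
proof -
  have minty: "0 \<le> (y - l) \<bullet> V y" for y
  proof -
    have "((\<lambda>k. z k \<bullet> V (z k)) \<longlongrightarrow> 0) G"
    proof (rule tendsto_0_le[where K = M])
      show "((\<lambda>k. V (z k)) \<longlongrightarrow> 0) G" by (rule residual)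
      have "norm (z k \<bullet> V (z k)) \<le> norm (V (z k)) * M" for k
        using Cauchy_Schwarz_ineq2[of "z k" "V (z k)"] mult_right_mono[OF bound[of k] norm_ge_zero[of "V (z k)"]]
        by (simp add: mult.commute)
      then show "eventually (\<lambda>k. norm (z k \<bullet> V (z k)) \<le> norm (V (z k)) * M) G" by simp
    qed
    then have "((\<lambda>k. y \<bullet> V y - z k \<bullet> V y - y \<bullet> V (z k) + z k \<bullet> V (z k))
        \<longlongrightarrow> y \<bullet> V y - l \<bullet> V y - y \<bullet> 0 + 0) G"
      by (intro tendsto_intros weak residual)
    moreover have "0 \<le> y \<bullet> V y - z k \<bullet> V y - y \<bullet> V (z k) + z k \<bullet> V (z k)" for k
      using mono unfolding monotone_operator_def by (simp add: inner_simps algebra_simps)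
    ultimately have "0 \<le> y \<bullet> V y - l \<bullet> V y - y \<bullet> 0 + 0"
      by (intro tendsto_lowerbound[OF _ _ G]) auto
    then show ?thesis by (simp add: inner_simps)
  qed
  have "0 \<le> - (V l) \<bullet> V l"
  proof (rule tendsto_lowerbound)
    have "((\<lambda>t. l - t *\<^sub>R V l) \<longlongrightarrow> l - 0 *\<^sub>R V l) (at_right (0::real))"
      by (intro tendsto_intros)
    then have "((\<lambda>t. V (l - t *\<^sub>R V l)) \<longlongrightarrow> V (l - 0 *\<^sub>R V l)) (at_right (0::real))"
      by (rule continuous_on_tendsto_compose[OF cont]) auto
    then have "((\<lambda>t. - V l \<bullet> V (l - t *\<^sub>R V l)) \<longlongrightarrow> - V l \<bullet> V (l - 0 *\<^sub>R V l)) (at_right (0::real))"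
      by (intro tendsto_intros)
    then show "((\<lambda>t. - V l \<bullet> V (l - t *\<^sub>R V l)) \<longlongrightarrow> - V l \<bullet> V l) (at_right (0::real))" by simp
    show "eventually (\<lambda>t. 0 \<le> - V l \<bullet> V (l - t *\<^sub>R V l)) (at_right (0::real))"
      using eventually_at_right_less[of 0]
    proof eventually_elim
      case (elim t)
      have "0 \<le> t * (- V l \<bullet> V (l - t *\<^sub>R V l))" using minty[of "l - t *\<^sub>R V l"] by simp
      then show ?case using elim by (simp add: zero_le_mult_iff mult_le_0_iff)
    qed
  qed simp
  then show ?thesis by (metis inner_eq_zero_iff inner_ge_zero inner_minus_left neg_0_le_iff_le order_antisym)
qed

text \<open>Two weak cluster points \<open>l\<close> and \<open>p\<close> coincide: the difference of \<open>\<parallel>z k - p\<parallel>\<^sup>2\<close> and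
  \<open>\<parallel>z k - l\<parallel>\<^sup>2\<close> is affine in \<open>z k\<close>, so \<open>\<langle>z k, l - p\<rangle>\<close> converges, and evaluating its limit along
  the two filters gives \<open>\<langle>l, l - p\<rangle> = \<langle>p, l - p\<rangle>\<close>. By weak compactness a unique cluster point is
  the weak limit.\<close>

theorem opial:
  fixes z :: "nat \<Rightarrow> 'a::{real_inner, complete_space}"
  assumes "S \<noteq> {}"
    and dist_conv: "\<And>p. p \<in> S \<Longrightarrow> convergent (\<lambda>k. (norm (z k - p))\<^sup>2)"
    and bound: "\<And>k. norm (z k) \<le> M"
    and cluster: "\<And>G l. G \<le> sequentially \<Longrightarrow> G \<noteq> bot \<Longrightarrow>
      (\<And>y. ((\<lambda>k. z k \<bullet> y) \<longlongrightarrow> l \<bullet> y) G) \<Longrightarrow> l \<in> S"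
  shows "\<exists>l\<in>S. weakly_converges_to z l"
proof -
  have unique: "l = p" 
    if G: "G \<le> sequentially" "G \<noteq> bot" "\<And>y. ((\<lambda>k. z k \<bullet> y) \<longlongrightarrow> l \<bullet> y) G"
      and H: "H \<le> sequentially" "H \<noteq> bot" "\<And>y. ((\<lambda>k. z k \<bullet> y) \<longlongrightarrow> p \<bullet> y) H" for G H l p
  proof -
    have S: "l \<in> S" "p \<in> S" using cluster G H by blast+
    obtain a b where a: "(\<lambda>k. (norm (z k - l))\<^sup>2) \<longlonglongrightarrow> a" and b: "(\<lambda>k. (norm (z k - p))\<^sup>2) \<longlonglongrightarrow> b"
      using S dist_conv unfolding convergent_def by blast
    have "(\<lambda>k. ((norm (z k - p))\<^sup>2 - (norm (z k - l))\<^sup>2 + (norm l)\<^sup>2 - (norm p)\<^sup>2) / 2)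
        \<longlonglongrightarrow> (b - a + (norm l)\<^sup>2 - (norm p)\<^sup>2) / 2"
      by (intro tendsto_intros a b) simp
    also have "(\<lambda>k. ((norm (z k - p))\<^sup>2 - (norm (z k - l))\<^sup>2 + (norm l)\<^sup>2 - (norm p)\<^sup>2) / 2)
        = (\<lambda>k. z k \<bullet> (l - p))"
      by (simp add: fun_eq_iff power2_norm_eq_inner inner_simps inner_commute field_simps)
    finally obtain c where c: "(\<lambda>k. z k \<bullet> (l - p)) \<longlonglongrightarrow> c" by blast
    have "l \<bullet> (l - p) = c"
      using tendsto_unique[OF G(2) G(3) filterlim_mono[OF c order_refl G(1)]] .
    moreover have "p \<bullet> (l - p) = c"
      using tendsto_unique[OF H(2) H(3) filterlim_mono[OF c order_refl H(1)]] .
    ultimately have "(l - p) \<bullet> (l - p) = 0" by (simp add: inner_diff_left)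
    then show ?thesis by simp
  qed
  from bounded_weak_cluster_point[where z = z, OF bound sequentially_bot]
  obtain G l where G: "G \<le> sequentially" "G \<noteq> bot" "\<And>y. ((\<lambda>k. z k \<bullet> y) \<longlongrightarrow> l \<bullet> y) G"
    by blast
  have lim: "(\<lambda>k. z k \<bullet> y) \<longlonglongrightarrow> l \<bullet> y" for y
  proof (rule ccontr)
    assume "\<not> ?thesis"
    then obtain e where e: "e > 0" "frequently (\<lambda>k. \<not> dist (z k \<bullet> y) (l \<bullet> y) < e) sequentially"
      unfolding tendsto_iff frequently_def by auto
    \<comment> \<open>Failure of convergence leaves a cluster point of the indices that stay away from \<open>l\<close>.\<close>
    define A where "A = {k. \<not> dist (z k \<bullet> y) (l \<bullet> y) < e}"
    have "inf sequentially (principal A) \<noteq> bot"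
      using e(2) unfolding trivial_limit_def eventually_inf_principal frequently_def A_def by simp
    from bounded_weak_cluster_point[where z = z, OF bound this]
    obtain H p where H: "H \<le> inf sequentially (principal A)" "H \<noteq> bot"
        "\<And>y. ((\<lambda>k. z k \<bullet> y) \<longlongrightarrow> p \<bullet> y) H"
      by blast
    have "p = l" using unique[OF _ H(2,3) G] H(1) by simp
    then have "eventually (\<lambda>k. dist (z k \<bullet> y) (l \<bullet> y) < e) H"
      using H(3)[of y] e(1) unfolding tendsto_iff by blast
    moreover have "eventually (\<lambda>k. k \<in> A) H"
      using H(1) by (simp add: le_principal)
    ultimately have "eventually (\<lambda>k. False) H" by eventually_elim (simp add: A_def)
    then show False using H(2) by (simp add: trivial_limit_def)
  qed
  have "weakly_converges_to z l"
    unfolding weakly_converges_to_def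
  proof (intro allI impI)
    fix f :: "'a \<Rightarrow> real" assume "bounded_linear f"
    then obtain v where "\<And>y. f y = v \<bullet> y" by (rule riesz_representation) blast
    then show "(\<lambda>k. f (z k)) \<longlonglongrightarrow> f l" using lim[of v] by (simp add: inner_commute)
  qed
  then show ?thesis using cluster[OF G] by blast
qed

section \<open>Two facts about real sequences\<close>

lemma decreasing_with_dissipation:
  fixes E g :: "nat \<Rightarrow> real"
  assumes E: "\<And>k. 0 \<le> E k" and g: "\<And>k. 0 \<le> g k"
    and step: "\<And>k. N \<le> k \<Longrightarrow> E (Suc k) + g (Suc k) \<le> E k"
  shows "convergent E" and "summable g"
proof -
  have "decseq (\<lambda>k. E (k + N))"
    unfolding decseq_Suc_iff
  proof
    fix k show "E (Suc k + N) \<le> E (k + N)" using step[of "k + N"] g[of "Suc (k + N)"] by simp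
  qed
  then have "convergent (\<lambda>k. E (k + N))"
    using E decseq_convergent[of "\<lambda>k. E (k + N)" 0] unfolding convergent_def by blast
  then show "convergent E" by (simp add: convergent_ignore_initial_segment)
  have "summable (\<lambda>k. g (k + Suc N))"
  proof (rule summableI_nonneg_bounded[where x = "E N"])
    fix n
    have "(\<Sum>k<n. g (k + Suc N)) + E (n + N) \<le> E N"
    proof (induction n)
      case (Suc n)
      then show ?case using step[of "n + N"] by simp
    qed simp
    then show "(\<Sum>k<n. g (k + Suc N)) \<le> E N" using E[of "n + N"] by linarith
  qed (rule g)
  then show "summable g" by (simp only: summable_iff_shift)
qed

text \<open>The discrete analogue of: if \<open>a q + t q'\<close> converges then so does \<open>q\<close>. The error
  \<open>e k = Q k - L / a\<close> satisfies \<open>(a + k + 1) e (k + 1) = (k + 1) e k + o(1)\<close>. Its excess over a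
  tolerance \<open>\<delta>\<close> then shrinks by the factor \<open>(k + 1) / (a + k + 1)\<close> or better, and since \<open>a \<ge> 1\<close> this
  telescopes to a bound \<open>O(1 / k)\<close>.\<close>

lemma discrete_lhopital:
  fixes Q :: "nat \<Rightarrow> real"
  assumes a: "a \<ge> 1"
    and lim: "(\<lambda>k. a * Q (Suc k) + real (Suc k) * (Q (Suc k) - Q k)) \<longlonglongrightarrow> L"
  shows "Q \<longlonglongrightarrow> L / a"
proof (rule LIMSEQ_I)
  fix r :: real assume r: "0 < r"
  define \<delta> where "\<delta> = r / 2"
  define e where "e k = Q k - L / a" for k
  have "0 < a * \<delta>" using r a by (simp add: \<delta>_def)
  then obtain N where N: "\<bar>a * Q (Suc k) + real (Suc k) * (Q (Suc k) - Q k) - L\<bar> < a * \<delta>" if "k \<ge> N" for k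
    using LIMSEQ_D[OF lim] by (metis real_norm_def)
  define f where "f k = max 0 (\<bar>e k\<bar> - \<delta>)" for k
  have step: "real (Suc k + 1) * f (Suc k) \<le> real (k + 1) * f k" if "k \<ge> N" for k
  proof (cases "f (Suc k) = 0")
    case False
    have "(a + real (Suc k)) * e (Suc k) - real (Suc k) * e k
        = a * Q (Suc k) + real (Suc k) * (Q (Suc k) - Q k) - L"
      using a by (simp add: e_def field_simps)
    then have "\<bar>(a + real (Suc k)) * e (Suc k)\<bar> \<le> \<bar>real (Suc k) * e k\<bar> + a * \<delta>"
      using N[OF that] by linarith
    then have "(a + real (Suc k)) * \<bar>e (Suc k)\<bar> \<le> real (Suc k) * \<bar>e k\<bar> + a * \<delta>"
      using a by (simp add: abs_mult)
    then have "(a + real (Suc k)) * (\<bar>e (Suc k)\<bar> - \<delta>) \<le> real (Suc k) * (\<bar>e k\<bar> - \<delta>)"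
      by (simp add: algebra_simps)
    moreover have "real (Suc k) * (\<bar>e k\<bar> - \<delta>) \<le> real (Suc k) * f k"
      by (intro mult_left_mono) (auto simp: f_def)
    moreover have "\<bar>e (Suc k)\<bar> - \<delta> = f (Suc k)" using False by (simp add: f_def max_def split: if_splits)
    moreover have "(1 + real (Suc k)) * f (Suc k) \<le> (a + real (Suc k)) * f (Suc k)"
      using a by (intro mult_right_mono) (auto simp: f_def)
    ultimately have "(1 + real (Suc k)) * f (Suc k) \<le> real (Suc k) * f k"
      by (metis order_trans)
    then show ?thesis by (simp add: add.commute)
  qed (simp add: f_def)
  have bound: "real (k + 1) * f k \<le> real (N + 1) * f N" if "k \<ge> N" for k
    using that by (induction k rule: dec_induct) (use step in \<open>auto intro: order_trans\<close>)
  have "(\<lambda>k. real (N + 1) * f N * (1 / real (Suc k))) \<longlonglongrightarrow> real (N + 1) * f N * 0"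
    by (intro tendsto_intros lim_1_over_n[THEN LIMSEQ_Suc])
  moreover have "0 < r / 2" using r by simp
  ultimately have "eventually (\<lambda>k. real (N + 1) * f N * (1 / real (Suc k)) < r / 2) sequentially"
    by (intro order_tendstoD) auto
  then obtain N' where N': "real (N + 1) * f N * (1 / real (Suc k)) < r / 2" if "k \<ge> N'" for k
    unfolding eventually_sequentially by blast
  have "norm (Q k - L / a) < r" if "k \<ge> max N N'" for k
  proof -
    have "f k \<le> real (N + 1) * f N * (1 / real (Suc k))"
      using bound[of k] that by (simp add: field_simps)
    also have "\<dots> < r / 2" using N'[of k] that by simp
    finally show ?thesis by (simp add: f_def e_def \<delta>_def max_def split: if_splits)
  qed
  then show "\<exists>no. \<forall>n\<ge>no. norm (Q n - L / a) < r" by blast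
qed

section \<open>The discrete energy\<close>

text \<open>After the parameters \<open>\<alpha>\<close> and \<open>\<mu>\<close>, the arguments stand for \<open>k\<close>, \<open>b\<^sub>k\<close>, \<open>x\<^sub>k = z\<^sub>k - p\<close>, \<open>d\<^sub>k = z\<^sub>k - z\<^sub>k\<^sub>-\<^sub>1\<close> and
  \<open>v\<^sub>k = V z\<^sub>k\<close>. The vector inside the first norm is chosen so that its increment along the
  iteration contains no term of order \<open>k d\<^sub>k\<close>; the remaining summands turn the mixed products that
  arise from its square into differences.\<close>

definition energy :: "real \<Rightarrow> real \<Rightarrow> real \<Rightarrow> real \<Rightarrow> 'a::real_inner \<Rightarrow> 'a \<Rightarrow> 'a \<Rightarrow> real" where
  "energy \<alpha> \<mu> k b x d v =
     (norm ((2 * \<mu>) *\<^sub>R x + (2 * k) *\<^sub>R d + (k * b) *\<^sub>R v))\<^sup>2 / 2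
     + 2 * \<mu> * (\<alpha> - 1 - \<mu>) * (norm x)\<^sup>2 + 2 * \<mu> * k * b * (x \<bullet> v) + (k * b)\<^sup>2 / 2 * (norm v)\<^sup>2"

text \<open>The terms quadratic in \<open>\<mu>\<close> cancel between the square and the coefficient
  \<open>2 \<mu> (\<alpha> - 1 - \<mu>)\<close>.\<close>

lemma energy_difference:
  "energy \<alpha> \<mu> k b x d v - energy \<alpha> \<nu> k b x d v
     = 2 * (\<mu> - \<nu>) * ((\<alpha> - 1) * (norm x)\<^sup>2 + 2 * k * (x \<bullet> (d + b *\<^sub>R v)))"
  unfolding energy_def power2_norm_eq_inner
  by (simp add: inner_simps inner_commute power2_eq_square field_simps)

text \<open>An exact balance. With \<open>u\<close> the vector inside the square, the recursion gives
  \<open>u\<^sub>k\<^sub>+\<^sub>1 - u\<^sub>k = - \<Delta>\<close> for an explicit \<open>\<Delta>\<close>, and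
  \<open>\<parallel>u\<^sub>k\<^sub>+\<^sub>1\<parallel>\<^sup>2 - \<parallel>u\<^sub>k\<parallel>\<^sup>2 = - 2 \<langle>u\<^sub>k\<^sub>+\<^sub>1, \<Delta>\<rangle> - \<parallel>\<Delta>\<parallel>\<^sup>2\<close>. Every term is written at the new index, with
  \<open>v\<^sub>k\<close> entering only through \<open>v\<^sub>k\<^sub>+\<^sub>1 - v\<^sub>k\<close>, so that monotonicity can be applied.\<close>

lemma energy_increment:
  fixes x0 x1 d0 d1 v0 v1 :: "'a::real_inner" and \<alpha> \<mu> k b0 b1 :: real
  defines "g \<equiv> (k + 1) * b1 - k * b0" and "\<theta> \<equiv> \<alpha> - 1 - \<mu>"
  assumes rec: "(k + \<alpha>) *\<^sub>R d1 - k *\<^sub>R d0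
      = - ((\<alpha> * b1 + k * (b1 - b0)) / 2) *\<^sub>R v1 - (k * b0) *\<^sub>R (v1 - v0)"
    and d1: "d1 = x1 - x0"
  shows "energy \<alpha> \<mu> (k + 1) b1 x1 d1 v1 - energy \<alpha> \<mu> k b0 x0 d0 v0
     = - 2 * \<mu> * ((\<alpha> - 1) * b1 - g) * (x1 \<bullet> v1)
       - 2 * k * b0 * (k + 1 + \<mu>) * (d1 \<bullet> (v1 - v0))
       - (4 * (k + 1) * \<theta> + 2 * \<mu> * \<theta>) * (norm d1)\<^sup>2
       - (4 * \<theta> * (k + 1) * b1 + 2 * \<mu> * g) * (d1 \<bullet> v1)
       - ((\<alpha> - 1) * (k + 1) * b1\<^sup>2 - g * ((k + 1) * b1 + k * b0) / 2) * (norm v1)\<^sup>2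
       - k * b0 * g * (v1 \<bullet> (v1 - v0)) - (k * b0)\<^sup>2 / 2 * (norm (v1 - v0))\<^sup>2
       - (norm ((2 * \<theta>) *\<^sub>R d1 + ((\<alpha> - 1) * b1) *\<^sub>R v1 + (k * b0) *\<^sub>R (v1 - v0)))\<^sup>2 / 2"
proof -
  define u0 where "u0 = (2 * \<mu>) *\<^sub>R x0 + (2 * k) *\<^sub>R d0 + (k * b0) *\<^sub>R v0"
  define u1 where "u1 = (2 * \<mu>) *\<^sub>R x1 + (2 * (k + 1)) *\<^sub>R d1 + ((k + 1) * b1) *\<^sub>R v1"
  define \<Delta> where "\<Delta> = (2 * \<theta>) *\<^sub>R d1 + ((\<alpha> - 1) * b1) *\<^sub>R v1 + (k * b0) *\<^sub>R (v1 - v0)"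
  have "u0 = u1 + \<Delta>"
  proof (rule vector_eq_rdot[THEN iffD1], intro allI)
    fix y
    have "((k + \<alpha>) *\<^sub>R d1 - k *\<^sub>R d0) \<bullet> y
      = (- ((\<alpha> * b1 + k * (b1 - b0)) / 2) *\<^sub>R v1 - (k * b0) *\<^sub>R (v1 - v0)) \<bullet> y"
      using rec by simp
    then show "u0 \<bullet> y = (u1 + \<Delta>) \<bullet> y"
      by (simp add: u0_def u1_def \<Delta>_def d1 \<theta>_def inner_simps field_simps)
  qed
  then have "(norm u1)\<^sup>2 / 2 - (norm u0)\<^sup>2 / 2 = - (u1 \<bullet> \<Delta>) - (norm \<Delta>)\<^sup>2 / 2"
    by (simp add: power2_norm_eq_inner inner_simps inner_commute field_simps)
  moreover have "- (u1 \<bullet> \<Delta>) + 2 * \<mu> * \<theta> * ((norm x1)\<^sup>2 - (norm x0)\<^sup>2)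
      + 2 * \<mu> * ((k + 1) * b1 * (x1 \<bullet> v1) - k * b0 * (x0 \<bullet> v0))
      + ((k + 1) * b1)\<^sup>2 / 2 * (norm v1)\<^sup>2 - (k * b0)\<^sup>2 / 2 * (norm v0)\<^sup>2
     = - 2 * \<mu> * ((\<alpha> - 1) * b1 - g) * (x1 \<bullet> v1)
       - 2 * k * b0 * (k + 1 + \<mu>) * (d1 \<bullet> (v1 - v0))
       - (4 * (k + 1) * \<theta> + 2 * \<mu> * \<theta>) * (norm d1)\<^sup>2
       - (4 * \<theta> * (k + 1) * b1 + 2 * \<mu> * g) * (d1 \<bullet> v1)
       - ((\<alpha> - 1) * (k + 1) * b1\<^sup>2 - g * ((k + 1) * b1 + k * b0) / 2) * (norm v1)\<^sup>2
       - k * b0 * g * (v1 \<bullet> (v1 - v0)) - (k * b0)\<^sup>2 / 2 * (norm (v1 - v0))\<^sup>2"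
  proof -
    have x0: "x0 = x1 - d1" by (simp add: d1)
    show ?thesis
      unfolding x0 power2_norm_eq_inner u1_def \<Delta>_def g_def \<theta>_def
      by (simp add: inner_simps inner_commute power2_eq_square field_simps)
  qed
  ultimately show ?thesis
    unfolding energy_def u0_def[symmetric] u1_def[symmetric] \<Delta>_def[symmetric] \<theta>_def[symmetric]
    by (simp add: right_diff_distrib mult.assoc)
qed

text \<open>The leading part \<open>K (4 \<theta> D\<^sup>2 - 4 \<theta> D H + \<epsilon> H\<^sup>2) = K (\<theta> (2 D - H)\<^sup>2 + (\<epsilon> - \<theta>) H\<^sup>2)\<close> is
  positive definite exactly when \<open>0 < \<theta> < \<epsilon>\<close>. Part of it absorbs the terms of lower order in
  \<open>K\<close> once \<open>K\<close> is large. Here \<open>D\<close> and \<open>H\<close> stand for \<open>\<parallel>d\<parallel>\<close> and \<open>b \<parallel>v\<parallel>\<close>.\<close>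

lemma dissipation_form_bound:
  fixes D H K \<theta> \<epsilon> \<mu> M m :: real
  assumes "0 \<le> D" "0 \<le> H" "0 \<le> \<mu>" "0 \<le> M" "0 \<le> m" "m \<le> \<theta>" "m \<le> \<epsilon> - \<theta>" "0 \<le> K"
    and K: "2 * \<mu> * M + M\<^sup>2 \<le> K * m"
  shows "m / 2 * K * D\<^sup>2
     \<le> 4 * K * \<theta> * D\<^sup>2 - (4 * \<theta> * K + 2 * \<mu> * M) * (D * H) + (\<epsilon> * K - M\<^sup>2 / 2) * H\<^sup>2"
proof -
  have "m * (D\<^sup>2 + H\<^sup>2 / 2) \<le> m * ((2 * D - H)\<^sup>2 + H\<^sup>2)"
  proof (rule mult_left_mono)
    have "0 \<le> (3 * D - 2 * H)\<^sup>2 + H\<^sup>2 / 2" by simp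
    then have "0 \<le> (9 * D\<^sup>2 - 12 * (D * H) + 9 / 2 * H\<^sup>2) / 3"
      by (simp add: power2_eq_square algebra_simps)
    then show "D\<^sup>2 + H\<^sup>2 / 2 \<le> (2 * D - H)\<^sup>2 + H\<^sup>2"
      by (simp add: power2_eq_square algebra_simps)
  qed (use assms in auto)
  also have "\<dots> = m * (2 * D - H)\<^sup>2 + m * H\<^sup>2" by (simp add: distrib_left)
  also have "\<dots> \<le> \<theta> * (2 * D - H)\<^sup>2 + (\<epsilon> - \<theta>) * H\<^sup>2"
    using assms by (intro add_mono mult_right_mono) auto
  also have "\<dots> = 4 * \<theta> * D\<^sup>2 - 4 * \<theta> * (D * H) + \<epsilon> * H\<^sup>2"
    by (simp add: power2_eq_square algebra_simps)
  finally have "K * (m * (D\<^sup>2 + H\<^sup>2 / 2)) \<le> K * (4 * \<theta> * D\<^sup>2 - 4 * \<theta> * (D * H) + \<epsilon> * H\<^sup>2)"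
    using assms by (intro mult_left_mono) auto
  moreover have "\<mu> * M * (2 * (D * H)) \<le> \<mu> * M * (D\<^sup>2 + H\<^sup>2)"
    using assms sum_squares_bound[of D H] by (intro mult_left_mono) (auto simp: mult.assoc)
  moreover have "\<mu> * M * (D\<^sup>2 + H\<^sup>2) + M\<^sup>2 / 2 * H\<^sup>2 \<le> K * m * (D\<^sup>2 / 2 + H\<^sup>2 / 2)"
  proof -
    have "\<mu> * M * (D\<^sup>2 + H\<^sup>2) + M\<^sup>2 / 2 * H\<^sup>2 \<le> (2 * \<mu> * M + M\<^sup>2) * (D\<^sup>2 / 2 + H\<^sup>2 / 2)"
      by (simp add: algebra_simps)
    also have "\<dots> \<le> K * m * (D\<^sup>2 / 2 + H\<^sup>2 / 2)"
      by (intro mult_right_mono K) simp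
    finally show ?thesis .
  qed
  ultimately show ?thesis by (simp add: algebra_simps)
qed

text \<open>In the exact balance, the terms with \<open>\<langle>x, v\<rangle>\<close> and \<open>\<langle>d, v\<^sub>1 - v\<^sub>0\<rangle>\<close> are controlled by
  monotonicity, the former with a margin \<open>\<epsilon>\<close> from the growth condition. The product
  \<open>\<langle>v\<^sub>1, v\<^sub>1 - v\<^sub>0\<rangle>\<close> is absorbed by \<open>\<parallel>v\<^sub>1 - v\<^sub>0\<parallel>\<^sup>2\<close> at the price of a multiple of
  \<open>b\<^sup>2 \<parallel>v\<^sub>1\<parallel>\<^sup>2\<close> without the factor \<open>k\<close>. What is left is the quadratic form of the preceding
  lemma.\<close>

lemma energy_dissipation:
  fixes x0 x1 d0 d1 v0 v1 :: "'a::real_inner" and \<alpha> \<mu> k b0 b1 \<epsilon> m :: real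
  defines "\<theta> \<equiv> \<alpha> - 1 - \<mu>"
  assumes rec: "(k + \<alpha>) *\<^sub>R d1 - k *\<^sub>R d0
      = - ((\<alpha> * b1 + k * (b1 - b0)) / 2) *\<^sub>R v1 - (k * b0) *\<^sub>R (v1 - v0)"
    and d1: "d1 = x1 - x0"
    and pos: "0 \<le> k" "0 \<le> b0" "0 \<le> \<mu>" "0 \<le> m" "0 \<le> \<epsilon>" "1 \<le> \<alpha>" and b: "b0 \<le> b1"
    and growth: "k * (b1 - b0) \<le> (\<alpha> - 2 - \<epsilon>) * b1"
    and mono: "0 \<le> d1 \<bullet> (v1 - v0)" "0 \<le> x1 \<bullet> v1"
    and m: "m \<le> \<theta>" "m \<le> \<epsilon> - \<theta>"
    and large: "2 * \<mu> * (\<alpha> - 1) + (\<alpha> - 1)\<^sup>2 \<le> (k + 1) * m"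
  shows "energy \<alpha> \<mu> (k + 1) b1 x1 d1 v1 + 2 * \<mu> * \<epsilon> * (b1 * (x1 \<bullet> v1)) + m / 2 * ((k + 1) * (norm d1)\<^sup>2)
     \<le> energy \<alpha> \<mu> k b0 x0 d0 v0"
proof -
  define g where "g = (k + 1) * b1 - k * b0"
  define K where "K = k + 1"
  define D where "D = norm d1"
  define H where "H = b1 * norm v1"
  have b1: "0 \<le> b1" using pos b by simp
  have kb: "k * b0 \<le> K * b1" unfolding K_def using pos b by (intro mult_mono) auto
  have g0: "0 \<le> g" using kb by (simp add: g_def K_def)
  have g1: "g \<le> (\<alpha> - 1 - \<epsilon>) * b1" using growth by (simp add: g_def algebra_simps)
  have g2: "g \<le> (\<alpha> - 1) * b1"
    using g1 mult_nonneg_nonneg[OF pos(5) b1] by (simp add: algebra_simps)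
  have xv: "2 * \<mu> * \<epsilon> * (b1 * (x1 \<bullet> v1)) \<le> 2 * \<mu> * ((\<alpha> - 1) * b1 - g) * (x1 \<bullet> v1)"
  proof -
    have "\<epsilon> * b1 \<le> (\<alpha> - 1) * b1 - g" using g1 by (simp add: algebra_simps)
    then have "2 * \<mu> * (\<epsilon> * b1) * (x1 \<bullet> v1) \<le> 2 * \<mu> * ((\<alpha> - 1) * b1 - g) * (x1 \<bullet> v1)"
      using pos mono by (intro mult_right_mono mult_left_mono) auto
    then show ?thesis by (simp add: mult.assoc)
  qed
  have dw: "0 \<le> 2 * k * b0 * (k + 1 + \<mu>) * (d1 \<bullet> (v1 - v0))"
    using pos mono by simp
  have dd: "4 * K * \<theta> * D\<^sup>2 \<le> (4 * (k + 1) * \<theta> + 2 * \<mu> * \<theta>) * (norm d1)\<^sup>2"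
    using pos m by (simp add: K_def D_def distrib_right)
  have dv: "- ((4 * \<theta> * K + 2 * \<mu> * (\<alpha> - 1)) * (D * H)) \<le> (4 * \<theta> * (k + 1) * b1 + 2 * \<mu> * g) * (d1 \<bullet> v1)"
  proof -
    have "- (D * norm v1) \<le> d1 \<bullet> v1"
      using Cauchy_Schwarz_ineq2[of d1 v1] by (simp add: D_def abs_le_iff)
    then have "(4 * \<theta> * K * b1 + 2 * \<mu> * g) * - (D * norm v1) \<le> (4 * \<theta> * K * b1 + 2 * \<mu> * g) * (d1 \<bullet> v1)"
      using pos m b1 g0 by (intro mult_left_mono) (auto simp: K_def)
    moreover have "(4 * \<theta> * K * b1 + 2 * \<mu> * g) * (D * norm v1) \<le> (4 * \<theta> * K * b1 + 2 * \<mu> * ((\<alpha> - 1) * b1)) * (D * norm v1)"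
      using pos g2 by (intro mult_right_mono add_left_mono mult_left_mono) (auto simp: D_def)
    ultimately show ?thesis by (simp add: K_def H_def algebra_simps)
  qed
  have vv: "\<epsilon> * K * H\<^sup>2 \<le> ((\<alpha> - 1) * (k + 1) * b1\<^sup>2 - g * ((k + 1) * b1 + k * b0) / 2) * (norm v1)\<^sup>2"
  proof -
    have "g * (K * b1 + k * b0) / 2 \<le> g * (K * b1)"
      using mult_left_mono[OF kb g0] by (simp add: algebra_simps)
    also have "\<dots> \<le> ((\<alpha> - 1 - \<epsilon>) * b1) * (K * b1)"
      using g1 b1 pos by (intro mult_right_mono) (auto simp: K_def)
    finally have "\<epsilon> * K * b1\<^sup>2 \<le> (\<alpha> - 1) * K * b1\<^sup>2 - g * (K * b1 + k * b0) / 2"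
      by (simp add: power2_eq_square algebra_simps)
    then have "\<epsilon> * K * b1\<^sup>2 * (norm v1)\<^sup>2 \<le> ((\<alpha> - 1) * K * b1\<^sup>2 - g * (K * b1 + k * b0) / 2) * (norm v1)\<^sup>2"
      by (intro mult_right_mono) auto
    then show ?thesis by (simp add: H_def K_def power_mult_distrib mult.assoc)
  qed
  \<comment> \<open>Completing the square of \<open>g v\<^sub>1 + k b\<^sub>0 (v\<^sub>1 - v\<^sub>0)\<close>.\<close>
  have vw: "- ((\<alpha> - 1)\<^sup>2 / 2 * H\<^sup>2) \<le> k * b0 * g * (v1 \<bullet> (v1 - v0)) + (k * b0)\<^sup>2 / 2 * (norm (v1 - v0))\<^sup>2"
  proof -
    have "0 \<le> (norm (g *\<^sub>R v1 + (k * b0) *\<^sub>R (v1 - v0)))\<^sup>2" by simp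
    also have "\<dots> = g\<^sup>2 * (norm v1)\<^sup>2 + 2 * (k * b0 * g * (v1 \<bullet> (v1 - v0))) + (k * b0)\<^sup>2 * (norm (v1 - v0))\<^sup>2"
      unfolding power2_norm_eq_inner
      by (simp add: inner_simps inner_commute power2_eq_square algebra_simps)
    finally have "- (g\<^sup>2 * (norm v1)\<^sup>2 / 2) \<le> k * b0 * g * (v1 \<bullet> (v1 - v0)) + (k * b0)\<^sup>2 / 2 * (norm (v1 - v0))\<^sup>2"
      by simp
    moreover have "g\<^sup>2 * (norm v1)\<^sup>2 \<le> ((\<alpha> - 1) * b1)\<^sup>2 * (norm v1)\<^sup>2"
      using g0 g2 by (intro mult_right_mono power_mono) auto
    ultimately show ?thesis by (simp add: H_def power_mult_distrib mult.assoc)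
  qed
  have form: "m / 2 * K * D\<^sup>2 \<le> 4 * K * \<theta> * D\<^sup>2 - (4 * \<theta> * K + 2 * \<mu> * (\<alpha> - 1)) * (D * H)
      + (\<epsilon> * K * H\<^sup>2 - (\<alpha> - 1)\<^sup>2 / 2 * H\<^sup>2)"
    using dissipation_form_bound[of D H \<mu> "\<alpha> - 1" m \<theta> \<epsilon> K] pos b1 m large
    by (simp add: D_def H_def K_def left_diff_distrib)
  have sq: "0 \<le> (norm ((2 * \<theta>) *\<^sub>R d1 + ((\<alpha> - 1) * b1) *\<^sub>R v1 + (k * b0) *\<^sub>R (v1 - v0)))\<^sup>2 / 2"
    by simp
  have "m / 2 * ((k + 1) * (norm d1)\<^sup>2) = m / 2 * K * D\<^sup>2"
    by (simp add: K_def D_def)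
  then show ?thesis
    using energy_increment[OF rec d1, of \<mu>] xv dw dd dv vv vw form sq
    unfolding g_def[symmetric] \<theta>_def[symmetric] by linarith
qed

section \<open>Convergence of the iterates\<close>

lemma energy_lower_bound:
  assumes "0 \<le> \<mu>" "\<mu> \<le> \<alpha> - 1" "0 \<le> k" "0 \<le> b" "0 \<le> x \<bullet> v"
  shows "(k * b)\<^sup>2 / 2 * (norm v)\<^sup>2 \<le> energy \<alpha> \<mu> k b x d v"
  using assms by (simp add: energy_def)

text \<open>The part of the argument that concerns one fixed zero, located at the origin. The difference of
  the energies for two parameters isolates \<open>P\<close>. Adding the partial sums \<open>S\<close> of the
  dissipated products to the squared norms absorbs the term \<open>2 k b\<^sub>k \<langle>x\<^sub>k, v\<^sub>k\<rangle>\<close> of \<open>P\<close>: it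
  becomes \<open>k\<close> times an increment.\<close>

lemma fast_ogda_distance_converges:
  fixes x v :: "nat \<Rightarrow> 'a::real_inner" and b :: "nat \<Rightarrow> real" and \<alpha> \<epsilon> :: real
  assumes \<epsilon>: "0 < \<epsilon>" "\<epsilon> \<le> \<alpha> - 2"
    and b: "\<And>k. 0 < b k" "mono b"
    and growth: "\<And>k. 1 \<le> k \<Longrightarrow> real k * (b (Suc k) - b k) \<le> (\<alpha> - 2 - \<epsilon>) * b (Suc k)"
    and rec: "\<And>k. 1 \<le> k \<Longrightarrow> (real k + \<alpha>) *\<^sub>R (x (Suc k) - x k) - real k *\<^sub>R (x k - x (k - 1))
      = - ((\<alpha> * b (Suc k) + real k * (b (Suc k) - b k)) / 2) *\<^sub>R v (Suc k)
        - (real k * b k) *\<^sub>R (v (Suc k) - v k)"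
    and mono: "\<And>j k. 0 \<le> (x j - x k) \<bullet> (v j - v k)" "\<And>k. 0 \<le> x k \<bullet> v k"
  shows "convergent (\<lambda>k. (norm (x k))\<^sup>2)" and "v \<longlonglongrightarrow> 0"
proof -
  define d where "d k = x k - x (k - 1)" for k
  define E where "E \<theta> k = energy \<alpha> (\<alpha> - 1 - \<theta>) (real k) (b k) (x k) (d k) (v k)" for \<theta> k
  have lower: "(real k * b k)\<^sup>2 / 2 * (norm (v k))\<^sup>2 \<le> E \<theta> k" if "0 < \<theta>" "\<theta> < \<epsilon>" for \<theta> k
    unfolding E_def using that \<epsilon> b(1)[of k] mono(2) by (intro energy_lower_bound) auto
  have nonneg: "0 \<le> E \<theta> k" if "0 < \<theta>" "\<theta> < \<epsilon>" for \<theta> k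
    using lower[OF that, of k] by (rule order_trans[rotated]) simp
  have decay: "convergent (E \<theta>) \<and> summable (\<lambda>k. b k * (x k \<bullet> v k)) \<and> (\<lambda>k. real k * (norm (d k))\<^sup>2) \<longlonglongrightarrow> 0"
    if \<theta>: "0 < \<theta>" "\<theta> < \<epsilon>" for \<theta>
  proof -
    define \<mu> where "\<mu> = \<alpha> - 1 - \<theta>"
    define m where "m = min \<theta> (\<epsilon> - \<theta>)"
    define g where "g k = 2 * \<mu> * \<epsilon> * (b k * (x k \<bullet> v k)) + m / 2 * (real k * (norm (d k))\<^sup>2)" for k
    have pos: "0 < m" "0 < \<mu>" using \<theta> \<epsilon> by (auto simp: m_def \<mu>_def)
    have parts: "0 \<le> b k * (x k \<bullet> v k)" "0 \<le> real k * (norm (d k))\<^sup>2" for k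
      using b(1)[of k] mono(2)[of k] by auto
    obtain N where N: "(2 * \<mu> * (\<alpha> - 1) + (\<alpha> - 1)\<^sup>2) / m \<le> real N"
      using real_arch_simple by blast
    have "E \<theta> (Suc k) + g (Suc k) \<le> E \<theta> k" if "max 1 N \<le> k" for k
    proof -
      have k: "1 \<le> k" "real N \<le> real k" using that by auto
      have large: "2 * \<mu> * (\<alpha> - 1) + (\<alpha> - 1)\<^sup>2 \<le> (real k + 1) * m"
      proof -
        have "2 * \<mu> * (\<alpha> - 1) + (\<alpha> - 1)\<^sup>2 \<le> real N * m"
          using N pos by (simp add: pos_divide_le_eq)
        also have "\<dots> \<le> (real k + 1) * m" using k pos by (intro mult_right_mono) auto
        finally show ?thesis .
      qed
      have "energy \<alpha> \<mu> (real k + 1) (b (Suc k)) (x (Suc k)) (d (Suc k)) (v (Suc k))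
          + 2 * \<mu> * \<epsilon> * (b (Suc k) * (x (Suc k) \<bullet> v (Suc k))) + m / 2 * ((real k + 1) * (norm (d (Suc k)))\<^sup>2)
        \<le> energy \<alpha> \<mu> (real k) (b k) (x k) (d k) (v k)"
      proof (rule energy_dissipation)
        show "(real k + \<alpha>) *\<^sub>R d (Suc k) - real k *\<^sub>R d k
            = - ((\<alpha> * b (Suc k) + real k * (b (Suc k) - b k)) / 2) *\<^sub>R v (Suc k)
              - (real k * b k) *\<^sub>R (v (Suc k) - v k)"
          using rec[OF k(1)] by (simp add: d_def)
        show "d (Suc k) = x (Suc k) - x k" by (simp add: d_def)
        show "0 \<le> d (Suc k) \<bullet> (v (Suc k) - v k)" using mono(1) by (simp add: d_def)
        show "b k \<le> b (Suc k)" using b(2) by (simp add: monoD)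
        show "0 \<le> b k" using b(1)[of k] by simp
      qed (use pos \<epsilon> growth[OF k(1)] mono(2) large in \<open>auto simp: m_def \<mu>_def\<close>)
      then show ?thesis by (simp add: E_def g_def \<mu>_def add_ac)
    qed
    moreover have "0 \<le> g k" for k
    proof -
      have "0 \<le> 2 * \<mu> * \<epsilon>" "0 \<le> m / 2" using pos \<epsilon> by auto
      then show ?thesis
        unfolding g_def using parts[of k] by (meson add_nonneg_nonneg mult_nonneg_nonneg)
    qed
    ultimately have conv: "convergent (E \<theta>)" and sum: "summable g"
      using decreasing_with_dissipation[of "E \<theta>" g "max 1 N"] nonneg[OF \<theta>] by blast+
    have "summable (\<lambda>k. g k / (2 * \<mu> * \<epsilon>))" using sum by (rule summable_divide)
    then have s1: "summable (\<lambda>k. b k * (x k \<bullet> v k))"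
    proof (rule summable_comparison_test')
      fix k
      show "norm (b k * (x k \<bullet> v k)) \<le> g k / (2 * \<mu> * \<epsilon>)"
        using parts[of k] pos \<epsilon> by (simp add: g_def field_simps)
    qed
    have "summable (\<lambda>k. g k / (m / 2))" using sum by (rule summable_divide)
    then have "summable (\<lambda>k. real k * (norm (d k))\<^sup>2)"
    proof (rule summable_comparison_test')
      fix k
      have "m / 2 * (real k * (norm (d k))\<^sup>2) \<le> g k"
        using parts[of k] pos \<epsilon> by (simp add: g_def)
      then show "norm (real k * (norm (d k))\<^sup>2) \<le> g k / (m / 2)"
        using pos by (simp add: field_simps)
    qed
    with conv s1 show ?thesis by (simp add: summable_LIMSEQ_zero)
  qed
  \<comment> \<open>Any two distinct values in the admissible range \<open>(0, \<epsilon>)\<close> would do.\<close>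
  define \<theta> where "\<theta> = \<epsilon> / 2"
  define \<theta>' where "\<theta>' = \<epsilon> / 4"
  have \<theta>: "0 < \<theta>" "\<theta> < \<epsilon>" "0 < \<theta>'" "\<theta>' < \<epsilon>" using \<epsilon> by (auto simp: \<theta>_def \<theta>'_def)
  define P where "P k = (\<alpha> - 1) * (norm (x k))\<^sup>2 + 2 * real k * (x k \<bullet> (d k + b k *\<^sub>R v k))" for k
  define S where "S k = (\<Sum>i<Suc k. b i * (x i \<bullet> v i))" for k
  obtain e e' where e: "E \<theta> \<longlonglongrightarrow> e" "E \<theta>' \<longlonglongrightarrow> e'"
    using decay \<theta> unfolding convergent_def by blast
  have "E \<theta>' k - E \<theta> k = \<epsilon> / 2 * P k" for k
    unfolding E_def energy_difference P_def by (simp add: \<theta>_def \<theta>'_def)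
  then have "P k = (E \<theta>' k - E \<theta> k) / (\<epsilon> / 2)" for k using \<epsilon> by simp
  then have "P = (\<lambda>k. (E \<theta>' k - E \<theta> k) / (\<epsilon> / 2))" by blast
  then have P: "P \<longlonglongrightarrow> (e' - e) / (\<epsilon> / 2)" using \<epsilon> e by (auto intro!: tendsto_intros)
  obtain s where S: "S \<longlonglongrightarrow> s"
    using decay[OF \<theta>(1,2)] unfolding S_def summable_def sums_def by (blast dest: LIMSEQ_Suc)
  have kd: "(\<lambda>k. real k * (norm (d k))\<^sup>2) \<longlonglongrightarrow> 0" using decay \<theta> by blast
  define Q where "Q k = (norm (x k))\<^sup>2 + 2 * S k" for k
  have "(\<alpha> - 1) * Q (Suc k) + real (Suc k) * (Q (Suc k) - Q k)
      = P (Suc k) - real (Suc k) * (norm (d (Suc k)))\<^sup>2 + 2 * (\<alpha> - 1) * S (Suc k)" for k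
  proof -
    have "x k = x (Suc k) - d (Suc k)" by (simp add: d_def)
    then have "(norm (x (Suc k)))\<^sup>2 - (norm (x k))\<^sup>2 = 2 * (x (Suc k) \<bullet> d (Suc k)) - (norm (d (Suc k)))\<^sup>2"
      by (simp only: power2_norm_eq_inner inner_simps inner_commute)
    moreover have "S (Suc k) - S k = b (Suc k) * (x (Suc k) \<bullet> v (Suc k))" by (simp add: S_def)
    ultimately have "Q (Suc k) - Q k = 2 * (x (Suc k) \<bullet> d (Suc k)) - (norm (d (Suc k)))\<^sup>2
        + 2 * (b (Suc k) * (x (Suc k) \<bullet> v (Suc k)))"
      by (simp add: Q_def)
    then show ?thesis
      unfolding P_def by (simp only:) (simp add: Q_def inner_simps algebra_simps)
  qed
  then have "(\<lambda>k. (\<alpha> - 1) * Q (Suc k) + real (Suc k) * (Q (Suc k) - Q k))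
      \<longlonglongrightarrow> (e' - e) / (\<epsilon> / 2) - 0 + 2 * (\<alpha> - 1) * s"
    by (simp only:) (intro tendsto_intros P[THEN LIMSEQ_Suc] S[THEN LIMSEQ_Suc] kd[THEN LIMSEQ_Suc])
  then obtain q where "Q \<longlonglongrightarrow> q"
    using discrete_lhopital[of "\<alpha> - 1" Q] \<epsilon> by auto
  then have "(\<lambda>k. Q k - 2 * S k) \<longlonglongrightarrow> q - 2 * s"
    by (intro tendsto_intros S)
  then show "convergent (\<lambda>k. (norm (x k))\<^sup>2)"
    by (auto simp: Q_def convergent_def)
  \<comment> \<open>The last summand of the bounded energy controls \<open>k b\<^sub>k \<parallel>v\<^sub>k\<parallel>\<close>, and \<open>b\<close> stays above \<open>b 0 > 0\<close>.\<close>
  obtain c where c: "\<And>k. norm (E \<theta> k) \<le> c"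
    using convergent_imp_Bseq[of "E \<theta>"] decay \<theta> unfolding Bseq_def by blast
  have "norm (v k) \<le> sqrt (2 * c) / b 0 * (1 / real k)" if "1 \<le> k" for k
  proof -
    have "b 0 \<le> b k" using b(2) by (simp add: monoD)
    then have "real k * b 0 * norm (v k) \<le> real k * b k * norm (v k)"
      by (intro mult_right_mono mult_left_mono) auto
    also have "\<dots> \<le> sqrt (2 * c)"
      using lower[OF \<theta>(1,2), of k] c[of k] by (intro real_le_rsqrt) (simp add: power_mult_distrib)
    finally show ?thesis using b(1)[of 0] that by (simp add: field_simps)
  qed
  then have "eventually (\<lambda>k. norm (v k) \<le> sqrt (2 * c) / b 0 * (1 / real k)) sequentially"
    unfolding eventually_sequentially by blast
  moreover have "(\<lambda>k. sqrt (2 * c) / b 0 * (1 / real k)) \<longlonglongrightarrow> sqrt (2 * c) / b 0 * 0"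
    by (intro tendsto_intros lim_1_over_n)
  ultimately show "v \<longlonglongrightarrow> 0"
    by (intro Lim_null_comparison[where f = v]) auto
qed

text \<open>Multiplying the scheme by \<open>k + \<alpha>\<close> removes all denominators and brings it into the form that the
  energy estimate uses.\<close>

lemma implicit_fast_ogda_increments:
  fixes z :: "nat \<Rightarrow> 'a::real_inner"
  assumes ogda: "implicit_fast_ogda V \<alpha> s \<beta> z" and \<alpha>: "0 \<le> \<alpha>" and k: "1 \<le> k"
  shows "(real k + \<alpha>) *\<^sub>R (z (Suc k) - z k) - real k *\<^sub>R (z k - z (k - 1))
    = - ((\<alpha> * (s * \<beta> k) + real k * (s * \<beta> k - s * \<beta> (k - 1))) / 2) *\<^sub>R V (z (Suc k))
      - (real k * (s * \<beta> (k - 1))) *\<^sub>R (V (z (Suc k)) - V (z k))"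
proof (rule vector_eq_rdot[THEN iffD1], intro allI)
  fix y :: 'a
  define c where "c = real k + \<alpha>"
  have c: "0 < c" using \<alpha> k by (simp add: c_def)
  have expand: "c * ((p *\<^sub>R A - q *\<^sub>R B - r *\<^sub>R C) \<bullet> y)
      = c * p * (A \<bullet> y) - c * q * (B \<bullet> y) - c * r * (C \<bullet> y)" for p q r A B C
    by (simp add: inner_diff_left right_diff_distrib)
  have "z (Suc k) - z k = (1 - \<alpha> / c) *\<^sub>R (z k - z (k - 1))
      - (s * (\<alpha> * \<beta> k + real k * (\<beta> k - \<beta> (k - 1))) / (2 * c)) *\<^sub>R V (z (Suc k))
      - (s * real k * \<beta> (k - 1) / c) *\<^sub>R (V (z (Suc k)) - V (z k))"
    using ogda k unfolding implicit_fast_ogda_def c_def by (auto simp: algebra_simps)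
  then have "c * ((z (Suc k) - z k) \<bullet> y) = c * (((1 - \<alpha> / c) *\<^sub>R (z k - z (k - 1))
      - (s * (\<alpha> * \<beta> k + real k * (\<beta> k - \<beta> (k - 1))) / (2 * c)) *\<^sub>R V (z (Suc k))
      - (s * real k * \<beta> (k - 1) / c) *\<^sub>R (V (z (Suc k)) - V (z k))) \<bullet> y)"
    by simp
  also have "\<dots> = c * (1 - \<alpha> / c) * ((z k - z (k - 1)) \<bullet> y)
      - c * (s * (\<alpha> * \<beta> k + real k * (\<beta> k - \<beta> (k - 1))) / (2 * c)) * (V (z (Suc k)) \<bullet> y)
      - c * (s * real k * \<beta> (k - 1) / c) * ((V (z (Suc k)) - V (z k)) \<bullet> y)"
    by (rule expand)
  also have "c * (1 - \<alpha> / c) = real k" using c by (simp add: c_def field_simps)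
  also have "c * (s * (\<alpha> * \<beta> k + real k * (\<beta> k - \<beta> (k - 1))) / (2 * c))
      = (\<alpha> * (s * \<beta> k) + real k * (s * \<beta> k - s * \<beta> (k - 1))) / 2"
    using c by (simp add: field_simps)
  also have "c * (s * real k * \<beta> (k - 1) / c) = real k * (s * \<beta> (k - 1))"
    using c by simp
  finally show "((real k + \<alpha>) *\<^sub>R (z (Suc k) - z k) - real k *\<^sub>R (z k - z (k - 1))) \<bullet> y
    = (- ((\<alpha> * (s * \<beta> k) + real k * (s * \<beta> k - s * \<beta> (k - 1))) / 2) *\<^sub>R V (z (Suc k))
      - (real k * (s * \<beta> (k - 1))) *\<^sub>R (V (z (Suc k)) - V (z k))) \<bullet> y"
    unfolding c_def by (simp only: inner_diff_left inner_scaleR_left) 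
qed

theorem theorem11:
  fixes V :: "'a::{real_inner, complete_space} \<Rightarrow> 'a"
    and \<alpha> s :: real and \<beta> :: "nat \<Rightarrow> real" and z :: "nat \<Rightarrow> 'a"
  assumes "monotone_operator V"
    and "continuous_on UNIV V"
    and "zeros V \<noteq> {}"
    and "\<alpha> > 2"
    and "s > 0"
    and "\<And>k. \<beta> k > 0"
    and "mono \<beta>"
    and "0 \<le> (SUP k\<in>{1..}. ereal (real k * (\<beta> k - \<beta> (k - 1)) / \<beta> k))"
    and "(SUP k\<in>{1..}. ereal (real k * (\<beta> k - \<beta> (k - 1)) / \<beta> k)) < ereal (\<alpha> - 2)"
    and "implicit_fast_ogda V \<alpha> s \<beta> z"
  shows "\<exists>l\<in>zeros V. weakly_converges_to z l"
proof -
  obtain r where r: "(SUP k\<in>{1..}. ereal (real k * (\<beta> k - \<beta> (k - 1)) / \<beta> k)) = ereal r"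
    using assms(8,9) by (cases "SUP k\<in>{1..}. ereal (real k * (\<beta> k - \<beta> (k - 1)) / \<beta> k)") auto
  have r_bounds: "0 \<le> r" "r < \<alpha> - 2" using assms(8,9) unfolding r by auto
  have growth: "real k * (\<beta> k - \<beta> (k - 1)) \<le> r * \<beta> k" if "1 \<le> k" for k
  proof -
    have "ereal (real k * (\<beta> k - \<beta> (k - 1)) / \<beta> k) \<le> ereal r"
      unfolding r[symmetric] using that by (intro SUP_upper) auto
    then show ?thesis using assms(6)[of k] by (simp add: pos_divide_le_eq)
  qed
  \<comment> \<open>The index shift matches \<open>k \<beta>\<^sub>k\<^sub>-\<^sub>1\<close> in the scheme; \<open>b 0 = s \<beta>\<^sub>0\<close> by truncation, so \<open>b\<close> stays monotone.\<close>
  define b where "b k = s * \<beta> (k - 1)" for k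
  have towards_zero: "convergent (\<lambda>k. (norm (z k - p))\<^sup>2) \<and> (\<lambda>k. V (z k)) \<longlonglongrightarrow> 0" if p: "p \<in> zeros V" for p
  proof -
    define \<epsilon> where "\<epsilon> = \<alpha> - 2 - r"
    have \<epsilon>: "0 < \<epsilon>" "\<epsilon> \<le> \<alpha> - 2" using r_bounds by (auto simp: \<epsilon>_def)
    have b_pos: "0 < b k" for k using assms(5,6) by (simp add: b_def)
    have b_mono: "mono b"
      using assms(5) unfolding b_def by (intro monoI mult_left_mono monoD[OF assms(7)]) auto
    have b_growth: "real k * (b (Suc k) - b k) \<le> (\<alpha> - 2 - \<epsilon>) * b (Suc k)" if "1 \<le> k" for k
      using mult_left_mono[OF growth[OF that], of s] assms(5) by (simp add: b_def \<epsilon>_def algebra_simps)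
    have rec: "(real k + \<alpha>) *\<^sub>R ((z (Suc k) - p) - (z k - p)) - real k *\<^sub>R ((z k - p) - (z (k - 1) - p))
      = - ((\<alpha> * b (Suc k) + real k * (b (Suc k) - b k)) / 2) *\<^sub>R V (z (Suc k))
        - (real k * b k) *\<^sub>R (V (z (Suc k)) - V (z k))" if "1 \<le> k" for k
      using implicit_fast_ogda_increments[OF assms(10) _ that] assms(4) by (simp add: b_def)
    have mono: "0 \<le> ((z j - p) - (z k - p)) \<bullet> (V (z j) - V (z k))" for j k
      using assms(1) by (simp add: monotone_operator_def)
    have mono_p: "0 \<le> (z k - p) \<bullet> V (z k)" for k
      using assms(1) p unfolding monotone_operator_def zeros_def by (metis diff_zero mem_Collect_eq)
    show ?thesis
      using fast_ogda_distance_converges[where x = "\<lambda>k. z k - p" and v = "\<lambda>k. V (z k)",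
          OF \<epsilon> b_pos b_mono b_growth rec mono mono_p] by simp
  qed
  obtain p where p: "p \<in> zeros V" using assms(3) by blast
  obtain c where c: "\<And>k. (norm (z k - p))\<^sup>2 \<le> c"
    using convergent_imp_Bseq[of "\<lambda>k. (norm (z k - p))\<^sup>2"] towards_zero[OF p] unfolding Bseq_def by auto
  have bound: "norm (z k) \<le> sqrt c + norm p" for k
    using real_le_rsqrt[OF c[of k]] norm_triangle_sub[of "z k" p] by linarith
  show ?thesis
  proof (rule opial[OF assms(3) _ bound])
    show "convergent (\<lambda>k. (norm (z k - q))\<^sup>2)" if "q \<in> zeros V" for q
      using towards_zero[OF that] by blast
    show "l \<in> zeros V"
      if G: "G \<le> sequentially" "G \<noteq> bot" "\<And>y. ((\<lambda>k. z k \<bullet> y) \<longlongrightarrow> l \<bullet> y) G" for G l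
    proof -
      have "((\<lambda>k. V (z k)) \<longlongrightarrow> 0) G"
        using towards_zero[OF p] G(1) by (blast intro: filterlim_mono)
      then show ?thesis
        using weak_limit_is_zero[OF assms(1,2) G(2) bound G(3)] by (simp add: zeros_def)
    qed
  qed
qed

end
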